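(* Let $\sigma\in\mathcal{S}_k$ and $\tau\in\mathcal{S}_n$ with $\sigma\le\tau$ (i.e. $\tau$ contains $\sigma$ as a pattern), and fix an occurrence $\langle\sigma\rangle$ of $\sigma$ in $\tau$. If the pair $(\langle\sigma\rangle,\tau)$ has an interval block, then $\mu(\langle\sigma\rangle,\tau)=0$, where $\mu(\langle\sigma\rangle,\tau)$ is the Möbius function of the occurrence poset $[\langle\sigma\rangle,\tau]$ evaluated between its minimum and maximum elements.
   Context: Permutations are written in one-line notation. Two sequences of distinct integers are order isomorphic if their letters are in the same relative order of size. $\tau$ contains $\sigma$ if some subsequence $\tau(i_1)\cdots\tau(i_k)$ ($i_1<\dots<i_k$) is order isomorphic to $\sigma$; such a subsequence is an occurrence of $\sigma$ in $\tau$. An interval block of $\tau$ is a factor (consecutive substring) $\tau(a)\tau(a+1)\cdots\tau(a+b)$ with $b\ge 1$ whose set of values is $\{a',a'+1,\dots,a'+b\}$ for some $a'$. The pair $(\langle\sigma\rangle,\tau)$ has an interval block if $\tau$ has an interval block containing no letter of the occurrence $\langle\sigma\rangle$; otherwise the pair is interval free. Occurrence poset: let $C$ be the set of letters of $\tau$ not in $\langle\sigma\rangle$. For $S\subseteq C$, let $\langle\sigma\rangle+S$ denote the subsequence of $\tau$ consisting of the letters of $\langle\sigma\rangle$ and of $S$, recorded as its standard form (the order-isomorphic permutation of $\{1,\dots,k+|S|\}$) together with the set of positions occupied by the letters of $\langle\sigma\rangle$. Two subsets give the same element if they give the same standard form and the same set of marked positions. The elements of $[\langle\sigma\rangle,\tau]$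 are these objects, ordered by: $\rho\le\pi$ iff $\rho$ is obtained from $\pi$ by deleting some letters of $\pi$ not in the marked occurrence (equivalently $\rho=\langle\sigma\rangle+S$, $\pi=\langle\sigma\rangle+S'$ for some $S\subseteq S'$). Its minimum is $\langle\sigma\rangle$ ($S=\emptyset$) and its maximum is $\tau$ ($S=C$). The Möbius function of a poset is defined by $\mu(s,s)=1$ and $\mu(s,t)=-\sum_{s\le x<t}\mu(s,x)$ for $s<t$. *)

theory Defs
  imports
    Main
    "HOL-Library.Sublist"
    "HOL-Combinatorics.Multiset_Permutations"
begin

text \<open>A permutation of \<open>{1..n}\<close> in one-line notation is a list in
  \<open>permutations_of_set {1..n}\<close>. Its letters are pairwise distinct, so a subsequence
  is determined by its set of letters, and an occurrence is represented by the subsequence itself.\<close>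

definition order_iso :: "nat list \<Rightarrow> nat list \<Rightarrow> bool" where
  "order_iso xs ys \<longleftrightarrow> length xs = length ys \<and>
     (\<forall>i < length xs. \<forall>j < length xs. xs ! i < xs ! j \<longleftrightarrow> ys ! i < ys ! j)"

definition is_occurrence :: "nat list \<Rightarrow> nat list \<Rightarrow> nat list \<Rightarrow> bool" where
  "is_occurrence w \<sigma> \<tau> \<longleftrightarrow> subseq w \<tau> \<and> order_iso w \<sigma>"

definition contains_pattern :: "nat list \<Rightarrow> nat list \<Rightarrow> bool" where
  "contains_pattern \<tau> \<sigma> \<longleftrightarrow> (\<exists>w. is_occurrence w \<sigma> \<tau>)"

definition interval_block :: "nat list \<Rightarrow> nat list \<Rightarrow> bool" where
  "interval_block bs \<tau> \<longleftrightarrow> sublist bs \<tau> \<and>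
     (\<exists>a b. b \<ge> 1 \<and> length bs = b + 1 \<and> set bs = {a..a + b})"

definition has_interval_block :: "nat list \<Rightarrow> nat list \<Rightarrow> bool" where
  "has_interval_block w \<tau> \<longleftrightarrow> (\<exists>bs. interval_block bs \<tau> \<and> set bs \<inter> set w = {})"

definition std :: "nat list \<Rightarrow> nat list" where
  "std xs = map (\<lambda>x. card {y \<in> set xs. y \<le> x}) xs"

type_synonym marked_perm = "nat list \<times> nat set"

text \<open>The standard form of \<open>xs\<close> with the positions (counted from 0, as in \<open>xs ! i\<close>)
  of the letters in \<open>W\<close>.\<close>

definition marked_form :: "nat set \<Rightarrow> nat list \<Rightarrow> marked_perm" where
  "marked_form W xs = (std xs, {i. i < length xs \<and> xs ! i \<in> W})"

definition occ_plus :: "nat list \<Rightarrow> nat list \<Rightarrow> nat set \<Rightarrow> marked_perm" where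
  "occ_plus w \<tau> S = marked_form (set w) (filter (\<lambda>x. x \<in> set w \<union> S) \<tau>)"

definition marked_letters :: "marked_perm \<Rightarrow> nat set" where
  "marked_letters \<pi> = (\<lambda>i. fst \<pi> ! i) ` snd \<pi>"

definition obtained_by_deletion :: "marked_perm \<Rightarrow> marked_perm \<Rightarrow> bool" where
  "obtained_by_deletion \<rho> \<pi> \<longleftrightarrow>
     (\<exists>D \<subseteq> set (fst \<pi>) - marked_letters \<pi>.
        \<rho> = marked_form (marked_letters \<pi>) (filter (\<lambda>x. x \<notin> D) (fst \<pi>)))"

definition occ_elems :: "nat list \<Rightarrow> nat list \<Rightarrow> marked_perm set" where
  "occ_elems w \<tau> = {occ_plus w \<tau> S | S. S \<subseteq> set \<tau> - set w}"

definition occ_poset :: "nat list \<Rightarrow> nat list \<Rightarrow> marked_perm rel" where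
  "occ_poset w \<tau> = {(\<rho>, \<pi>). \<rho> \<in> occ_elems w \<tau> \<and> \<pi> \<in> occ_elems w \<tau> \<and> obtained_by_deletion \<rho> \<pi>}"

definition occ_min :: "nat list \<Rightarrow> nat list \<Rightarrow> marked_perm" where
  "occ_min w \<tau> = occ_plus w \<tau> {}"

definition occ_max :: "nat list \<Rightarrow> nat list \<Rightarrow> marked_perm" where
  "occ_max w \<tau> = occ_plus w \<tau> (set \<tau> - set w)"

text \<open>The guard (partial order, finite interval) makes the recursion terminate; it holds for every
  occurrence poset, see \<open>Partial_order_occ_poset\<close> and \<open>finite_Field_occ_poset\<close> below.\<close>

function moebius :: "'a rel \<Rightarrow> 'a \<Rightarrow> 'a \<Rightarrow> int" where
  "moebius r s t =
     (if s = t then 1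
      else if (s, t) \<in> r \<and> Partial_order r \<and> finite {x. (s, x) \<in> r \<and> (x, t) \<in> r}
      then - (\<Sum>x \<in> {x. (s, x) \<in> r \<and> (x, t) \<in> r \<and> x \<noteq> t}. moebius r s x)
      else 0)"
  by pat_completeness auto
termination
proof (relation "measure (\<lambda>(r, s, t). card {x. (s, x) \<in> r \<and> (x, t) \<in> r})", goal_cases)
  case 1
  then show ?case by simp
next
  case (2 r s t x)
  then have po: "trans r" "antisym r" "(t, t) \<in> r"
    by (auto simp: partial_order_on_def preorder_on_def refl_on_def Field_def)
  from 2 have x: "(s, x) \<in> r" "(x, t) \<in> r" "x \<noteq> t" and st: "(s, t) \<in> r"
    and fin: "finite {y. (s, y) \<in> r \<and> (y, t) \<in> r}" by auto
  have "{y. (s, y) \<in> r \<and> (y, x) \<in> r} \<subseteq> {y. (s, y) \<in> r \<and> (y, t) \<in> r}"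
    using transD[OF po(1) _ x(2)] by blast
  moreover have "(t, x) \<notin> r" using antisymD[OF po(2) x(2)] x(3) by blast
  ultimately have "{y. (s, y) \<in> r \<and> (y, x) \<in> r} \<subset> {y. (s, y) \<in> r \<and> (y, t) \<in> r}"
    using po(3) st by blast
  with fin show ?case by (simp add: psubset_card_mono)
qed

declare moebius.simps [simp del]

lemma moebius_refl: "moebius r s s = 1"
  by (simp add: moebius.simps)

lemma moebius_rec:
  assumes "Partial_order r" "finite (Field r)" "(s, t) \<in> r" "s \<noteq> t"
  shows "moebius r s t = - (\<Sum>x \<in> {x. (s, x) \<in> r \<and> (x, t) \<in> r \<and> x \<noteq> t}. moebius r s x)"
proof -
  have "finite {x. (s, x) \<in> r \<and> (x, t) \<in> r}"
    by (rule finite_subset[OF _ assms(2)]) (auto simp: Field_def)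
  with assms show ?thesis by (subst moebius.simps) simp
qed

lemma rank_less_iff:
  fixes x y :: nat
  assumes "x \<in> A" "y \<in> A" "finite A"
  shows "card {z \<in> A. z \<le> x} < card {z \<in> A. z \<le> y} \<longleftrightarrow> x < y"
proof
  assume "x < y"
  then have "{z \<in> A. z \<le> x} \<subseteq> {z \<in> A. z \<le> y}" "y \<in> {z \<in> A. z \<le> y} - {z \<in> A. z \<le> x}"
    using assms by auto
  then have "{z \<in> A. z \<le> x} \<subset> {z \<in> A. z \<le> y}" by blast
  then show "card {z \<in> A. z \<le> x} < card {z \<in> A. z \<le> y}"
    using assms by (intro psubset_card_mono) auto
next
  assume *: "card {z \<in> A. z \<le> x} < card {z \<in> A. z \<le> y}"
  show "x < y"
  proof (rule ccontr)
    assume "\<not> x < y"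
    then have "card {z \<in> A. z \<le> y} \<le> card {z \<in> A. z \<le> x}"
      using assms by (intro card_mono) auto
    with * show False by simp
  qed
qed

lemma length_std [simp]: "length (std xs) = length xs"
  by (simp add: std_def)

lemma order_iso_std: "order_iso (std xs) xs"
  by (auto simp: order_iso_def std_def rank_less_iff)

lemma std_permutation:
  assumes "distinct xs"
  shows "std xs \<in> permutations_of_set {1..length xs}"
proof -
  let ?f = "\<lambda>x. card {y \<in> set xs. y \<le> x}"
  have inj: "inj_on ?f (set xs)"
    by (rule inj_onI) (metis List.finite_set nat_neq_iff rank_less_iff)
  have "?f ` set xs = {1..length xs}"
  proof (rule card_subset_eq)
    show "?f ` set xs \<subseteq> {1..length xs}"
    proof safe
      fix x assume "x \<in> set xs"
      then have "card {y \<in> set xs. y \<le> x} > 0" by (auto simp: card_gt_0_iff)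
      moreover have "card {y \<in> set xs. y \<le> x} \<le> card (set xs)" by (rule card_mono) auto
      moreover have "card (set xs) \<le> length xs" by (rule card_length)
      ultimately show "?f x \<in> {1..length xs}" by simp
    qed
    show "card (?f ` set xs) = card {1..length xs}"
      using inj assms by (simp add: card_image distinct_card)
  qed simp
  with inj assms show ?thesis
    by (auto simp: permutations_of_set_def std_def distinct_map)
qed

lemma marked_form_map:
  assumes "strict_mono_on A f" "set xs \<subseteq> A" "W \<subseteq> A"
  shows "marked_form (f ` W) (map f xs) = marked_form W xs"
proof -
  have le: "f x \<le> f y \<longleftrightarrow> x \<le> y" if "x \<in> A" "y \<in> A" for x y
    using assms(1) that by (rule strict_mono_on_less_eq)
  have inj: "inj_on f A" using assms(1) by (rule strict_mono_on_imp_inj_on)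
  have "card {y \<in> f ` set xs. y \<le> f x} = card {y \<in> set xs. y \<le> x}" if "x \<in> set xs" for x
  proof -
    have "{y \<in> f ` set xs. y \<le> f x} = f ` {y \<in> set xs. y \<le> x}"
      using le assms(2) that by auto
    moreover have "inj_on f {y \<in> set xs. y \<le> x}"
      using inj by (rule inj_on_subset) (use assms in auto)
    ultimately show ?thesis by (simp add: card_image)
  qed
  then have "std (map f xs) = std xs" by (simp add: std_def)
  moreover have "f (xs ! i) \<in> f ` W \<longleftrightarrow> xs ! i \<in> W" if "i < length xs" for i
    using inj_on_image_mem_iff[OF inj, of "xs ! i" W] assms that nth_mem[OF that] by blast
  ultimately show ?thesis by (simp add: marked_form_def cong: conj_cong)
qed

lemma obtained_by_deletion_marked_form:
  assumes "W \<subseteq> set xs"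
  shows "obtained_by_deletion \<rho> (marked_form W xs) \<longleftrightarrow>
    (\<exists>D \<subseteq> set xs - W. \<rho> = marked_form W (filter (\<lambda>x. x \<notin> D) xs))"
proof -
  define f where "f = (\<lambda>x. card {y \<in> set xs. y \<le> x})"
  have mono: "strict_mono_on (set xs) f"
    by (auto simp: strict_mono_on_def f_def rank_less_iff)
  have inj: "inj_on f (set xs)" using mono by (rule strict_mono_on_imp_inj_on)
  have p: "fst (marked_form W xs) = map f xs" by (simp add: marked_form_def std_def f_def)
  have ml: "marked_letters (marked_form W xs) = f ` W"
  proof -
    have "marked_letters (marked_form W xs) = (\<lambda>i. f (xs ! i)) ` {i. i < length xs \<and> xs ! i \<in> W}"
      unfolding marked_letters_def p by (intro image_cong) (auto simp: marked_form_def)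
    also have "\<dots> = f ` ((\<lambda>i. xs ! i) ` {i. i < length xs \<and> xs ! i \<in> W})" by (simp add: image_image)
    also have "(\<lambda>i. xs ! i) ` {i. i < length xs \<and> xs ! i \<in> W} = W"
      using assms by (fastforce simp: in_set_conv_nth)
    finally show ?thesis .
  qed
  have del: "marked_form (f ` W) (filter (\<lambda>x. x \<notin> f ` D) (map f xs)) =
      marked_form W (filter (\<lambda>x. x \<notin> D) xs)" if "D \<subseteq> set xs" for D
  proof -
    have "filter (\<lambda>x. x \<notin> f ` D) (map f xs) = map f (filter (\<lambda>x. x \<notin> D) xs)"
      using inj_on_image_mem_iff[OF inj _ that] by (auto simp: filter_map o_def cong: filter_cong)
    then show ?thesis using marked_form_map[OF mono, of "filter (\<lambda>x. x \<notin> D) xs" W] assms by auto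
  qed
  have "(D' \<subseteq> f ` set xs - f ` W) \<longleftrightarrow> (\<exists>D \<subseteq> set xs - W. D' = f ` D)" for D'
    using inj_on_image_set_diff[OF inj, of "set xs" W] assms
      subset_image_iff[of D' f "set xs - W"] by auto
  then have "obtained_by_deletion \<rho> (marked_form W xs) \<longleftrightarrow> (\<exists>D \<subseteq> set xs - W.
      \<rho> = marked_form (f ` W) (filter (\<lambda>x. x \<notin> f ` D) (map f xs)))"
    unfolding obtained_by_deletion_def p ml set_map by auto
  also have "\<dots> \<longleftrightarrow> (\<exists>D \<subseteq> set xs - W. \<rho> = marked_form W (filter (\<lambda>x. x \<notin> D) xs))"
  proof (intro ex_cong1 conj_cong refl)
    fix D assume "D \<subseteq> set xs - W"
    then have "D \<subseteq> set xs" by blast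
    from del[OF this] show "(\<rho> = marked_form (f ` W) (filter (\<lambda>x. x \<notin> f ` D) (map f xs))) =
        (\<rho> = marked_form W (filter (\<lambda>x. x \<notin> D) xs))" by simp
  qed
  finally show ?thesis .
qed

lemma obtained_by_deletion_occ_plus:
  assumes "set w \<subseteq> set \<tau>" "S' \<subseteq> set \<tau> - set w"
  shows "obtained_by_deletion \<rho> (occ_plus w \<tau> S') \<longleftrightarrow> (\<exists>S \<subseteq> S'. \<rho> = occ_plus w \<tau> S)"
proof -
  let ?xs = "filter (\<lambda>x. x \<in> set w \<union> S') \<tau>"
  have sub: "set w \<subseteq> set ?xs" and eq: "set ?xs - set w = S'" using assms by auto
  have "filter (\<lambda>x. x \<notin> D) ?xs = filter (\<lambda>x. x \<in> set w \<union> (S' - D)) \<tau>" if "D \<subseteq> S'" for D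
    using that assms by (auto intro!: filter_cong)
  then have "obtained_by_deletion \<rho> (occ_plus w \<tau> S') \<longleftrightarrow>
      (\<exists>D \<subseteq> S'. \<rho> = occ_plus w \<tau> (S' - D))"
    unfolding occ_plus_def obtained_by_deletion_marked_form[OF sub] eq by metis
  also have "\<dots> \<longleftrightarrow> (\<exists>S \<subseteq> S'. \<rho> = occ_plus w \<tau> S)"
    by (metis Diff_subset double_diff order_refl)
  finally show ?thesis .
qed

lemma occ_poset_iff:
  assumes "set w \<subseteq> set \<tau>"
  shows "(\<rho>, \<pi>) \<in> occ_poset w \<tau> \<longleftrightarrow>
    (\<exists>S S'. S \<subseteq> S' \<and> S' \<subseteq> set \<tau> - set w \<and> \<rho> = occ_plus w \<tau> S \<and> \<pi> = occ_plus w \<tau> S')"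
    (is "?L \<longleftrightarrow> ?R")
proof
  assume ?L
  then obtain S' where S': "S' \<subseteq> set \<tau> - set w" "\<pi> = occ_plus w \<tau> S'"
    and "obtained_by_deletion \<rho> (occ_plus w \<tau> S')"
    unfolding occ_poset_def occ_elems_def by auto
  then obtain S where "S \<subseteq> S'" "\<rho> = occ_plus w \<tau> S"
    using obtained_by_deletion_occ_plus[OF assms S'(1)] by auto
  with S' show ?R by (intro exI conjI)
next
  assume ?R
  then obtain S S' where S: "S \<subseteq> S'" "S' \<subseteq> set \<tau> - set w"
    "\<rho> = occ_plus w \<tau> S" "\<pi> = occ_plus w \<tau> S'" by (elim exE conjE)
  then have "obtained_by_deletion \<rho> \<pi>"
    using obtained_by_deletion_occ_plus[OF assms S(2)] by auto
  moreover have "S \<subseteq> set \<tau> - set w" using S(1,2) by (rule order_trans)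
  ultimately show ?L using S unfolding occ_poset_def occ_elems_def by auto
qed

lemma Field_occ_poset:
  assumes "set w \<subseteq> set \<tau>"
  shows "Field (occ_poset w \<tau>) = occ_elems w \<tau>"
proof -
  have "Field (occ_poset w \<tau>) \<subseteq> occ_elems w \<tau>" by (auto simp: Field_def occ_poset_def)
  moreover have "(x, x) \<in> occ_poset w \<tau>" if "x \<in> occ_elems w \<tau>" for x
    using that unfolding occ_poset_iff[OF assms] occ_elems_def by auto
  ultimately show ?thesis by (blast intro: FieldI1)
qed

lemma finite_Field_occ_poset:
  assumes "set w \<subseteq> set \<tau>"
  shows "finite (Field (occ_poset w \<tau>))"
  unfolding Field_occ_poset[OF assms] occ_elems_def by simp

lemma Partial_order_occ_poset:
  assumes "set w \<subseteq> set \<tau>" "distinct \<tau>"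
  shows "Partial_order (occ_poset w \<tau>)"
proof -
  note iff = occ_poset_iff[OF assms(1)]
  have len: "length (fst (occ_plus w \<tau> S)) = card (set w) + card S" if "S \<subseteq> set \<tau> - set w" for S
  proof -
    have "length (fst (occ_plus w \<tau> S)) = card (set (filter (\<lambda>x. x \<in> set w \<union> S) \<tau>))"
      using assms(2) distinct_card[of "filter (\<lambda>x. x \<in> set w \<union> S) \<tau>"]
      by (simp add: occ_plus_def marked_form_def)
    also have "set (filter (\<lambda>x. x \<in> set w \<union> S) \<tau>) = set w \<union> S" using assms that by auto
    also have "card (set w \<union> S) = card (set w) + card S"
      using that by (intro card_Un_disjoint) (auto intro: finite_subset)
    finally show ?thesis .
  qed
  have "refl_on (Field (occ_poset w \<tau>)) (occ_poset w \<tau>)"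
    unfolding Field_occ_poset[OF assms(1)] refl_on_def iff occ_elems_def by auto
  moreover have "trans (occ_poset w \<tau>)"
  proof (rule transI)
    fix x y z assume xy: "(x, y) \<in> occ_poset w \<tau>" and yz: "(y, z) \<in> occ_poset w \<tau>"
    from yz obtain S' S'' where S: "S' \<subseteq> S''" "S'' \<subseteq> set \<tau> - set w"
      "y = occ_plus w \<tau> S'" "z = occ_plus w \<tau> S''" unfolding iff by blast
    from xy have "obtained_by_deletion x (occ_plus w \<tau> S')" using S by (simp add: occ_poset_def)
    then obtain S0 where "S0 \<subseteq> S'" "x = occ_plus w \<tau> S0"
      using obtained_by_deletion_occ_plus[OF assms(1), of S'] S by blast
    with S have "S0 \<subseteq> S''" "S'' \<subseteq> set \<tau> - set w" "x = occ_plus w \<tau> S0" "z = occ_plus w \<tau> S''"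
      by simp_all
    then show "(x, z) \<in> occ_poset w \<tau>" unfolding iff by (intro exI conjI)
  qed
  moreover have "antisym (occ_poset w \<tau>)"
  proof (rule antisymI)
    fix x y assume xy: "(x, y) \<in> occ_poset w \<tau>" and yx: "(y, x) \<in> occ_poset w \<tau>"
    have le: "length (fst a) \<le> length (fst b)" if "(a, b) \<in> occ_poset w \<tau>" for a b
    proof -
      from that obtain S S' where S: "S \<subseteq> S'" "S' \<subseteq> set \<tau> - set w"
        "a = occ_plus w \<tau> S" "b = occ_plus w \<tau> S'" unfolding iff by blast
      have "finite S'" using S(2) by (rule finite_subset) simp
      then have "card S \<le> card S'" using S(1) by (rule card_mono)
      with S show ?thesis using len[of S] len[of S'] by auto
    qed
    from xy obtain S S' where S: "S \<subseteq> S'" "S' \<subseteq> set \<tau> - set w"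
      "x = occ_plus w \<tau> S" "y = occ_plus w \<tau> S'" unfolding iff by blast
    have "length (fst x) = length (fst y)" using le[OF xy] le[OF yx] by simp
    with S have "card S = card S'" using len[of S] len[of S'] by auto
    moreover have "finite S'" using S(2) by (rule finite_subset) simp
    ultimately have "S = S'" using S(1) by (intro card_subset_eq)
    with S show "x = y" by simp
  qed
  ultimately show ?thesis
    by (auto simp: partial_order_on_def preorder_on_def Field_def)
qed

lemma occ_min_least:
  assumes "set w \<subseteq> set \<tau>" "\<pi> \<in> occ_elems w \<tau>"
  shows "(occ_min w \<tau>, \<pi>) \<in> occ_poset w \<tau>"
proof -
  from assms(2) obtain S where "S \<subseteq> set \<tau> - set w" "\<pi> = occ_plus w \<tau> S"
    unfolding occ_elems_def by auto
  then show ?thesis unfolding occ_poset_iff[OF assms(1)] occ_min_def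
    by (intro exI[of _ "{}"] exI[of _ "S"]) simp
qed

lemma occ_max_greatest:
  assumes "set w \<subseteq> set \<tau>" "\<pi> \<in> occ_elems w \<tau>"
  shows "(\<pi>, occ_max w \<tau>) \<in> occ_poset w \<tau>"
proof -
  from assms(2) obtain S where "S \<subseteq> set \<tau> - set w" "\<pi> = occ_plus w \<tau> S"
    unfolding occ_elems_def by auto
  then show ?thesis unfolding occ_poset_iff[OF assms(1)] occ_max_def
    by (intro exI[of _ "S"] exI[of _ "set \<tau> - set w"]) simp
qed

end

theory Submission
  imports Defs
begin

text \<open>Induction on the element \<open>\<pi>\<close> of the occurrence poset: every \<open>\<pi>\<close> with an interval block \<open>B\<close>
  satisfies \<open>\<mu>(\<langle>\<sigma>\<rangle>, \<pi>) = 0\<close>. Let \<open>z\<close> be \<open>\<pi>\<close> with \<open>B\<close> shrunk to a single letter. An element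
  \<open>x < \<pi>\<close> either retains at least two letters of \<open>B\<close>, which form an interval block of \<open>x\<close>, so that
  its contribution vanishes, or it retains at most one letter of \<open>B\<close>, and then \<open>x \<le> z\<close> because it
  does not matter which letter is kept. The remaining contributions sum to \<open>0\<close> since
  \<open>\<langle>\<sigma>\<rangle> < z\<close>.\<close>

text \<open>The recursion for \<open>moebius r s z\<close>, with the term at \<open>z\<close>
  brought to the side of the sum.\<close>

lemma sum_moebius_below_eq_0:
  assumes "Partial_order r" "finite (Field r)" "(s, z) \<in> r" "s \<noteq> z"
  shows "(\<Sum>x \<in> {x. (s, x) \<in> r \<and> (x, z) \<in> r}. moebius r s x) = 0"
proof -
  have fin: "finite {x. (s, x) \<in> r \<and> (x, z) \<in> r}"
    by (rule finite_subset[OF _ assms(2)]) (auto simp: Field_def)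
  have "(z, z) \<in> r"
    using assms(1,3) by (auto simp: partial_order_on_def preorder_on_def refl_on_def Field_def)
  then have "z \<in> {x. (s, x) \<in> r \<and> (x, z) \<in> r}" using assms(3) by simp
  moreover have "{x. (s, x) \<in> r \<and> (x, z) \<in> r} - {z} = {x. (s, x) \<in> r \<and> (x, z) \<in> r \<and> x \<noteq> z}"
    by blast
  ultimately show ?thesis
    using sum.remove[OF fin, of z "moebius r s"] moebius_rec[OF assms] by simp
qed

text \<open>In the recursion at \<open>t\<close>, every term outside the interval from
  \<open>s\<close> to \<open>z\<close> vanishes by hypothesis. What is left is the full sum over
  that interval, which is zero because \<open>s \<noteq> z\<close>.\<close>

lemma moebius_eq_0_if_support_below:
  assumes "Partial_order r" "finite (Field r)"
    and "(s, z) \<in> r" "s \<noteq> z" "(z, t) \<in> r" "z \<noteq> t"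
    and vanish: "\<And>x. (s, x) \<in> r \<Longrightarrow> (x, t) \<in> r \<Longrightarrow> x \<noteq> t \<Longrightarrow> (x, z) \<notin> r \<Longrightarrow> moebius r s x = 0"
  shows "moebius r s t = 0"
proof -
  have tr: "trans r" and as: "antisym r"
    using assms(1) by (auto simp: partial_order_on_def preorder_on_def)
  have st: "(s, t) \<in> r" using transD[OF tr assms(3,5)] .
  have "s \<noteq> t" using antisymD[OF as assms(3)] assms(4,5) by blast
  have "(\<Sum>x \<in> {x. (s, x) \<in> r \<and> (x, t) \<in> r \<and> x \<noteq> t}. moebius r s x)
      = (\<Sum>x \<in> {x. (s, x) \<in> r \<and> (x, z) \<in> r}. moebius r s x)"
  proof (rule sum.mono_neutral_right)
    show "finite {x. (s, x) \<in> r \<and> (x, t) \<in> r \<and> x \<noteq> t}"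
      by (rule finite_subset[OF _ assms(2)]) (auto simp: Field_def)
    \<comment> \<open>Antisymmetry keeps \<open>t\<close> itself from lying below
      \<open>z\<close>.\<close>
    show "{x. (s, x) \<in> r \<and> (x, z) \<in> r} \<subseteq> {x. (s, x) \<in> r \<and> (x, t) \<in> r \<and> x \<noteq> t}"
      using transD[OF tr _ assms(5)] antisymD[OF as _ assms(5)] assms(6) by blast
  qed (use vanish in blast)
  also have "\<dots> = 0" using assms by (intro sum_moebius_below_eq_0)
  finally show ?thesis using moebius_rec[OF assms(1,2) st \<open>s \<noteq> t\<close>] by simp
qed

text \<open>Unlike \<open>interval_block\<close>, this notion is invariant under order isomorphism, hence
  applies to subsequences of \<open>\<tau>\<close> that have not been standardized.\<close>

definition interval_factor :: "nat list \<Rightarrow> nat list \<Rightarrow> bool" where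
  "interval_factor bs xs \<longleftrightarrow> (\<exists>us vs. xs = us @ bs @ vs \<and>
     (\<forall>x \<in> set us \<union> set vs. (\<forall>b \<in> set bs. x < b) \<or> (\<forall>b \<in> set bs. b < x)))"

lemma interval_factor_filter:
  assumes "interval_factor bs xs"
  shows "interval_factor (filter P bs) (filter P xs)"
proof -
  from assms obtain us vs where "xs = us @ bs @ vs"
    "\<forall>x \<in> set us \<union> set vs. (\<forall>b \<in> set bs. x < b) \<or> (\<forall>b \<in> set bs. b < x)"
    unfolding interval_factor_def by blast
  then show ?thesis unfolding interval_factor_def
    by (intro exI[of _ "filter P us"] exI[of _ "filter P vs"]) auto
qed

text \<open>By distinctness a letter outside the block has a value outside
  \<open>{a..a + b}\<close>, hence lies below or above all of it.\<close>

lemma interval_block_imp_interval_factor: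
  assumes "interval_block bs \<tau>" "distinct \<tau>"
  shows "interval_factor bs \<tau>"
proof -
  from assms(1) obtain us vs a b where \<tau>: "\<tau> = us @ bs @ vs" and bs: "set bs = {a..a + b}"
    unfolding interval_block_def sublist_def by auto
  have "(\<forall>y \<in> set bs. x < y) \<or> (\<forall>y \<in> set bs. y < x)" if "x \<in> set us \<union> set vs" for x
  proof -
    have "x \<notin> set bs" using that assms(2) \<tau> by auto
    then show ?thesis by (auto simp: bs)
  qed
  with \<tau> show ?thesis unfolding interval_factor_def by blast
qed

text \<open>Each other letter compares in the same way with \<open>b\<close> and with
  \<open>c\<close>. So sending \<open>b\<close> to \<open>c\<close> and fixing the rest is strictly
  increasing on the letters present, and such a relabelling preserves the marked form.\<close>

lemma marked_form_replace_letter: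
  assumes "c \<notin> W" "b \<notin> W" "W \<subseteq> set us \<union> set vs"
    and sep: "\<And>x. x \<in> set us \<union> set vs \<Longrightarrow> x < b \<and> x < c \<or> b < x \<and> c < x"
  shows "marked_form W (us @ c # vs) = marked_form W (us @ b # vs)"
proof -
  let ?f = "id(b := c)" and ?A = "insert b (set us \<union> set vs)"
  have ne: "x \<noteq> b" if "x \<in> set us \<union> set vs" for x using sep[OF that] by auto
  have "strict_mono_on ?A ?f"
  proof (rule strict_mono_onI)
    fix x y assume "x \<in> ?A" "y \<in> ?A" "x < y"
    then show "?f x < ?f y" using sep[of x] sep[of y] by (cases "x = b"; cases "y = b") auto
  qed
  then have "marked_form (?f ` W) (map ?f (us @ b # vs)) = marked_form W (us @ b # vs)"
    by (rule marked_form_map) (use assms(3) in auto)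
  moreover have "?f ` W = W" using assms(2) by (auto simp: image_def)
  moreover have "map ?f us = us" "map ?f vs = vs"
    using ne by (auto intro!: map_idI)
  ultimately show ?thesis by simp
qed

lemma length_occ_plus:
  assumes "distinct \<tau>" "set w \<subseteq> set \<tau>" "S \<subseteq> set \<tau>"
  shows "length (fst (occ_plus w \<tau> S)) = card (set w \<union> S)"
proof -
  have "length (fst (occ_plus w \<tau> S)) = card (set (filter (\<lambda>x. x \<in> set w \<union> S) \<tau>))"
    using assms(1) distinct_card[of "filter (\<lambda>x. x \<in> set w \<union> S) \<tau>"]
    by (simp add: occ_plus_def marked_form_def)
  also have "set (filter (\<lambda>x. x \<in> set w \<union> S) \<tau>) = set w \<union> S" using assms by auto
  finally show ?thesis .
qed

text \<open>The length of the standard form determines the cardinality of the subset, which suffices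
  for nested subsets. Without nesting, distinct subsets may give the same element, as the next lemma
  shows.\<close>

lemma occ_plus_eq_imp_eq:
  assumes "distinct \<tau>" "set w \<subseteq> set \<tau>" "S \<subseteq> S'" "S' \<subseteq> set \<tau> - set w"
    and "occ_plus w \<tau> S = occ_plus w \<tau> S'"
  shows "S = S'"
proof -
  have "card (set w \<union> S) = card (set w \<union> S')"
    using length_occ_plus[of \<tau> w S] length_occ_plus[of \<tau> w S'] assms by auto
  moreover have "finite (set w \<union> S')" using assms(4) by (auto intro: finite_subset)
  ultimately have "set w \<union> S = set w \<union> S'" using assms(3) by (intro card_subset_eq) auto
  then show ?thesis using assms(3,4) by blast
qed

text \<open>A single letter of the block survives on each side. Whichever it is, it stands between
  the same remnants of \<open>us\<close> and \<open>vs\<close> and compares equally with all their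
  letters.\<close>

lemma occ_plus_replace_letter:
  assumes "distinct \<tau>" "set w \<subseteq> set \<tau>" "S \<subseteq> set \<tau> - set w"
    and "interval_factor bs (filter (\<lambda>x. x \<in> set w \<union> S) \<tau>)" "set bs \<inter> set w = {}"
    and "b \<in> set bs" "c \<in> set bs" and T: "T \<subseteq> S - set bs"
  shows "occ_plus w \<tau> (insert c T) = occ_plus w \<tau> (insert b T)"
proof -
  let ?xs = "filter (\<lambda>x. x \<in> set w \<union> S) \<tau>"
  from assms(4) obtain us vs where xs: "?xs = us @ bs @ vs"
    and sep: "\<And>x. x \<in> set us \<union> set vs \<Longrightarrow> (\<forall>b \<in> set bs. x < b) \<or> (\<forall>b \<in> set bs. b < x)"
    unfolding interval_factor_def by blast
  have dist: "distinct (us @ bs @ vs)" using assms(1) unfolding xs[symmetric] by simp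
  have set_xs: "set us \<union> set bs \<union> set vs = set w \<union> S"
    using arg_cong[OF xs, of set] assms(2,3) by auto
  define us' vs' where "us' = filter (\<lambda>x. x \<in> set w \<union> T) us"
    and "vs' = filter (\<lambda>x. x \<in> set w \<union> T) vs"
  have filt: "filter (\<lambda>x. x \<in> set w \<union> insert d T) \<tau> = us' @ d # vs'" if d: "d \<in> set bs" for d
  proof -
    have "d \<in> S" using d set_xs assms(5) by auto
    then have "filter (\<lambda>x. x \<in> set w \<union> insert d T) \<tau> = filter (\<lambda>x. x \<in> set w \<union> insert d T) ?xs"
      using T by (auto intro!: filter_cong)
    also have "\<dots> = us' @ filter (\<lambda>x. x \<in> set w \<union> insert d T) bs @ vs'"
      using dist d unfolding xs us'_def vs'_def filter_append
      by (intro arg_cong2[where f = append] filter_cong refl) auto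
    also have "filter (\<lambda>x. x \<in> set w \<union> insert d T) bs = filter (\<lambda>x. x = d) bs"
      using T assms(5) by (intro filter_cong) auto
    also have "\<dots> = [d]"
    proof -
      obtain ys zs where "bs = ys @ d # zs" using d by (meson split_list)
      moreover from this dist have "filter (\<lambda>x. x = d) ys = []" "filter (\<lambda>x. x = d) zs = []"
        by (auto simp: filter_empty_conv)
      ultimately show ?thesis by simp
    qed
    finally show ?thesis by simp
  qed
  have "marked_form (set w) (us' @ c # vs') = marked_form (set w) (us' @ b # vs')"
  proof (rule marked_form_replace_letter)
    show "set w \<subseteq> set us' \<union> set vs'" using set_xs assms(5) by (auto simp: us'_def vs'_def)
    show "x < b \<and> x < c \<or> b < x \<and> c < x" if "x \<in> set us' \<union> set vs'" for x
      using sep[of x] that assms(6,7) by (auto simp: us'_def vs'_def)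
  qed (use assms(5-7) in auto)
  then show ?thesis unfolding occ_plus_def filt[OF assms(6)] filt[OF assms(7)] .
qed

text \<open>Stated for every \<open>S\<close>, not only for the maximum, so that strong induction on
  \<open>card S\<close> covers the smaller elements. Since \<open>interval_factor\<close> admits
  factors of any length, the bound on \<open>length bs\<close> is imposed separately.\<close>

lemma moebius_occ_plus_eq_0:
  assumes "distinct \<tau>" "set w \<subseteq> set \<tau>" "S \<subseteq> set \<tau> - set w"
    and "interval_factor bs (filter (\<lambda>x. x \<in> set w \<union> S) \<tau>)" "set bs \<inter> set w = {}"
    and "length bs \<ge> 2"
  shows "moebius (occ_poset w \<tau>) (occ_min w \<tau>) (occ_plus w \<tau> S) = 0"
  using assms(3-6)
proof (induction "card S" arbitrary: S bs rule: less_induct)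
  case less
  note iff = occ_poset_iff[OF assms(2)]
  let ?xs = "filter (\<lambda>x. x \<in> set w \<union> S) \<tau>" and ?r = "occ_poset w \<tau>"
  have fin: "finite S" using less.prems(1) by (auto intro: finite_subset)
  from less.prems(2) obtain us vs where xs: "?xs = us @ bs @ vs"
    unfolding interval_factor_def by blast
  have "distinct ?xs" using assms(1) by simp
  then have "distinct bs" unfolding xs by simp
  have "set bs \<subseteq> set ?xs" unfolding xs by auto
  then have bsS: "set bs \<subseteq> S" using less.prems(3) by auto
  have card_bs: "card (set bs) \<ge> 2" using \<open>distinct bs\<close> less.prems(4) by (simp add: distinct_card)
  obtain b where b: "b \<in> set bs" using less.prems(4) by (cases bs) auto
  \<comment> \<open>The witness \<open>z\<close>: the block is collapsed to \<open>b\<close>.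
    Keeping \<open>b\<close> makes \<open>Z\<close> nonempty, so its element is not the minimum;
    losing another block letter makes it proper in \<open>S\<close>.\<close>
  define Z where "Z = insert b (S - set bs)"
  have Z: "Z \<subseteq> S" "Z \<subseteq> set \<tau> - set w" using b bsS less.prems(1) by (auto simp: Z_def)
  have "Z \<noteq> S"
  proof
    assume "Z = S"
    then have "set bs \<subseteq> {b}" using bsS by (auto simp: Z_def)
    then have "card (set bs) \<le> card {b}" by (intro card_mono) auto
    then show False using card_bs by simp
  qed
  show ?case
  proof (rule moebius_eq_0_if_support_below[where z = "occ_plus w \<tau> Z"])
    show "Partial_order ?r" using assms(1,2) by (intro Partial_order_occ_poset)
    show "finite (Field ?r)" using assms(2) by (rule finite_Field_occ_poset)
    show "(occ_min w \<tau>, occ_plus w \<tau> Z) \<in> ?r"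
      using Z by (intro occ_min_least assms) (auto simp: occ_elems_def)
    show "occ_min w \<tau> \<noteq> occ_plus w \<tau> Z"
      using occ_plus_eq_imp_eq[OF assms(1,2), of "{}" Z] Z unfolding occ_min_def
      by (auto simp: Z_def)
    show "(occ_plus w \<tau> Z, occ_plus w \<tau> S) \<in> ?r"
      using Z less.prems(1) unfolding iff by blast
    show "occ_plus w \<tau> Z \<noteq> occ_plus w \<tau> S"
      using occ_plus_eq_imp_eq[OF assms(1,2) Z(1) less.prems(1)] \<open>Z \<noteq> S\<close> by blast
  next
    fix x assume x: "(x, occ_plus w \<tau> S) \<in> ?r" "x \<noteq> occ_plus w \<tau> S" "(x, occ_plus w \<tau> Z) \<notin> ?r"
    \<comment> \<open>Deleting from this particular \<open>S\<close> yields a \<open>T\<close>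
      inside \<open>S\<close> itself, whereas \<open>iff\<close> would only provide some pair of
      nested representatives.\<close>
    from x(1) obtain T where T: "T \<subseteq> S" "x = occ_plus w \<tau> T"
      using obtained_by_deletion_occ_plus[OF assms(2) less.prems(1)] by (auto simp: occ_poset_def)
    let ?P = "\<lambda>x. x \<in> set w \<union> T"
    have "T \<noteq> S" using x(2) T by blast
    with T fin have "card T < card S" by (intro psubset_card_mono) auto
    moreover have "T \<subseteq> set \<tau> - set w" using T less.prems(1) by blast
    moreover have "filter ?P ?xs = filter ?P \<tau>" using T by (auto intro!: filter_cong)
    then have "interval_factor (filter ?P bs) (filter ?P \<tau>)"
      using interval_factor_filter[OF less.prems(2), of ?P] by simp
    moreover have "set (filter ?P bs) \<inter> set w = {}" using less.prems(3) by auto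
    \<comment> \<open>If at most one block letter survived, \<open>x\<close> would lie below the
      element of \<open>Z\<close>, contrary to the choice of \<open>x\<close>.\<close>
    moreover have "length (filter ?P bs) \<ge> 2"
    proof (rule ccontr)
      assume "\<not> 2 \<le> length (filter ?P bs)"
      moreover have "set (filter ?P bs) = T \<inter> set bs" using less.prems(3) by auto
      ultimately have le1: "card (T \<inter> set bs) \<le> 1" using card_length[of "filter ?P bs"] by simp
      have "\<exists>T' \<subseteq> Z. x = occ_plus w \<tau> T'"
      proof (cases "T \<inter> set bs = {}")
        case True
        then have "T \<subseteq> Z" using T by (auto simp: Z_def)
        with T show ?thesis by blast
      next
        case False
        then have "card (T \<inter> set bs) = 1" using le1 by (simp add: le_Suc_eq)
        then obtain c where c: "T \<inter> set bs = {c}" by (auto simp: card_1_singleton_iff)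
        then have "T = insert c (T - set bs)" and "c \<in> set bs" by auto
        \<comment> \<open>\<open>T\<close> need not be contained in \<open>Z\<close>, as
          \<open>c\<close> may differ from \<open>b\<close>; exchanging \<open>c\<close> for
          \<open>b\<close> gives a representative of \<open>x\<close> that is.\<close>
        moreover have "occ_plus w \<tau> (insert c (T - set bs)) = occ_plus w \<tau> (insert b (T - set bs))"
          using T(1) by (intro occ_plus_replace_letter[OF assms(1,2) less.prems(1-3) b \<open>c \<in> set bs\<close>]) auto
        ultimately have "x = occ_plus w \<tau> (insert b (T - set bs))" using T by simp
        moreover have "insert b (T - set bs) \<subseteq> Z" using T by (auto simp: Z_def)
        ultimately show ?thesis by blast
      qed
      then show False using x(3) Z(2) unfolding iff by blast
    qed
    ultimately show "moebius ?r (occ_min w \<tau>) x = 0" unfolding T(2) by (rule less.hyps)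
  qed
qed

theorem theorem3p1:
  fixes \<sigma> \<tau> w :: "nat list" and k n :: nat
  assumes "\<sigma> \<in> permutations_of_set {1..k}"
    and "\<tau> \<in> permutations_of_set {1..n}"
    and "contains_pattern \<tau> \<sigma>"
    and "is_occurrence w \<sigma> \<tau>"
    and "has_interval_block w \<tau>"
  shows "moebius (occ_poset w \<tau>) (occ_min w \<tau>) (occ_max w \<tau>) = 0"
proof -
  have dist: "distinct \<tau>" using assms(2) by (simp add: permutations_of_set_def)
  have w: "set w \<subseteq> set \<tau>" using assms(4) by (auto simp: is_occurrence_def elim: list_emb_set)
  from assms(5) obtain bs where bs: "interval_block bs \<tau>" "set bs \<inter> set w = {}"
    unfolding has_interval_block_def by blast
  \<comment> \<open>With all unmarked letters retained, the subsequence is \<open>\<tau>\<close>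
    itself, so the block of \<open>\<tau>\<close> serves for the maximum.\<close>
  have "filter (\<lambda>x. x \<in> set w \<union> (set \<tau> - set w)) \<tau> = \<tau>" by simp
  then have "interval_factor bs (filter (\<lambda>x. x \<in> set w \<union> (set \<tau> - set w)) \<tau>)"
    using interval_block_imp_interval_factor[OF bs(1) dist] by metis
  moreover have "length bs \<ge> 2" using bs(1) by (auto simp: interval_block_def)
  ultimately show ?thesis
    unfolding occ_max_def using bs(2) by (intro moebius_occ_plus_eq_0[OF dist w order_refl])
qed

end
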